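(* Let $\mathbf{C}$ be a firm category. Then the subunits in $\mathbf{C}$ form a (meet-)semilattice $\mathrm{ISub}(\mathbf{C})$ under the usual order of subobjects ($s \le t$ if and only if $s$ factors through $t$), with largest element $I$ (represented by $\mathrm{id}_I$), and with meets given by $$(s \colon S \rightarrowtail I) \wedge (t \colon T \rightarrowtail I) = \big(\lambda_I \circ (s \otimes t) \colon S \otimes T \rightarrowtail I\big).$$
   Context: Let $\mathbf{C}$ be a braided monoidal category with tensor unit $I$ and left unitors $\lambda_A \colon I \otimes A \to A$. An object name also denotes its identity morphism, so $s \otimes T$ means $s \otimes \mathrm{id}_T$. A subobject of $I$ is an equivalence class of monomorphisms $s \colon S \rightarrowtail I$, two being identified when they factor through each other. A subunit in $\mathbf{C}$ is a subobject $s \colon S \rightarrowtail I$ such that $s \otimes S \colon S \otimes S \to I \otimes S$ is an isomorphism. The collection of subunits is written $\mathrm{ISub}(\mathbf{C})$; size issues are disregarded (it is treated as a set). A category is firm when it is braided monoidal and $s \otimes T \colon S \otimes T \to I \otimes T$ is a monomorphism whenever $s \colon S \rightarrowtail I$ and $t \colon T \rightarrowtail I$ are subunits. *)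

theory Defs
  imports "HOL-Algebra.Lattice"
begin

section \<open>Categories\<close>

text \<open>
  The fields are total functions, but only their values on objects, on arrows and on
  composable pairs of arrows are constrained or used. \<open>Comp g f\<close> is ``\<open>g\<close> after \<open>f\<close>''.
\<close>

record ('o, 'm) category =
  Obj :: "'o set"
  Arr :: "'m set"
  Dom :: "'m \<Rightarrow> 'o"
  Cod :: "'m \<Rightarrow> 'o"
  Ident :: "'o \<Rightarrow> 'm" (\<open>\<ii>\<dd>\<index>\<close>)
  Comp :: "'m \<Rightarrow> 'm \<Rightarrow> 'm" (infixr \<open>\<bullet>\<index>\<close> 65)

definition Hom :: "('o, 'm, 'z) category_scheme \<Rightarrow> 'o \<Rightarrow> 'o \<Rightarrow> 'm set"
  where "Hom C A B = {f \<in> Arr C. Dom C f = A \<and> Cod C f = B}"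

locale category =
  fixes C (structure)
  assumes Dom_Obj: "f \<in> Arr C \<Longrightarrow> Dom C f \<in> Obj C"
    and Cod_Obj: "f \<in> Arr C \<Longrightarrow> Cod C f \<in> Obj C"
    and Ident_Hom: "A \<in> Obj C \<Longrightarrow> \<ii>\<dd> A \<in> Hom C A A"
    and Comp_Hom: "\<lbrakk>f \<in> Hom C A B; g \<in> Hom C B D\<rbrakk> \<Longrightarrow> g \<bullet> f \<in> Hom C A D"
    and Comp_Ident_left: "f \<in> Hom C A B \<Longrightarrow> \<ii>\<dd> B \<bullet> f = f"
    and Comp_Ident_right: "f \<in> Hom C A B \<Longrightarrow> f \<bullet> \<ii>\<dd> A = f"
    and Comp_assoc: "\<lbrakk>f \<in> Hom C A B; g \<in> Hom C B D; h \<in> Hom C D E\<rbrakk>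
      \<Longrightarrow> (h \<bullet> g) \<bullet> f = h \<bullet> (g \<bullet> f)"

definition monic :: "('o, 'm, 'z) category_scheme \<Rightarrow> 'm \<Rightarrow> bool"
  where "monic C m \<longleftrightarrow> m \<in> Arr C \<and>
    (\<forall>A \<in> Obj C. \<forall>f \<in> Hom C A (Dom C m). \<forall>g \<in> Hom C A (Dom C m).
      m \<bullet>\<^bsub>C\<^esub> f = m \<bullet>\<^bsub>C\<^esub> g \<longrightarrow> f = g)"

definition inverse_arrows :: "('o, 'm, 'z) category_scheme \<Rightarrow> 'm \<Rightarrow> 'm \<Rightarrow> bool"
  where "inverse_arrows C f g \<longleftrightarrow> f \<in> Arr C \<and> g \<in> Hom C (Cod C f) (Dom C f) \<and>
    g \<bullet>\<^bsub>C\<^esub> f = \<ii>\<dd>\<^bsub>C\<^esub> (Dom C f) \<and> f \<bullet>\<^bsub>C\<^esub> g = \<ii>\<dd>\<^bsub>C\<^esub> (Cod C f)"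

definition is_iso :: "('o, 'm, 'z) category_scheme \<Rightarrow> 'm \<Rightarrow> bool"
  where "is_iso C f \<longleftrightarrow> (\<exists>g. inverse_arrows C f g)"

definition iso_inv :: "('o, 'm, 'z) category_scheme \<Rightarrow> 'm \<Rightarrow> 'm"
  where "iso_inv C f = (THE g. inverse_arrows C f g)"


section \<open>Subobjects\<close>

definition monos_into :: "('o, 'm, 'z) category_scheme \<Rightarrow> 'o \<Rightarrow> 'm set"
  where "monos_into C X = {s. monic C s \<and> Cod C s = X}"

definition factors_through :: "('o, 'm, 'z) category_scheme \<Rightarrow> 'm \<Rightarrow> 'm \<Rightarrow> bool"
  where "factors_through C s t \<longleftrightarrow> (\<exists>h \<in> Hom C (Dom C s) (Dom C t). s = t \<bullet>\<^bsub>C\<^esub> h)"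

definition subobject_rel :: "('o, 'm, 'z) category_scheme \<Rightarrow> 'o \<Rightarrow> ('m \<times> 'm) set"
  where "subobject_rel C X = {(s, t). s \<in> monos_into C X \<and> t \<in> monos_into C X \<and>
    factors_through C s t \<and> factors_through C t s}"

definition subobject_class :: "('o, 'm, 'z) category_scheme \<Rightarrow> 'm \<Rightarrow> 'm set"
  where "subobject_class C s = subobject_rel C (Cod C s) `` {s}"

definition subobject_le :: "('o, 'm, 'z) category_scheme \<Rightarrow> 'm set \<Rightarrow> 'm set \<Rightarrow> bool"
  where "subobject_le C U V \<longleftrightarrow> (\<exists>s \<in> U. \<exists>t \<in> V. factors_through C s t)"


section \<open>Braided monoidal categories\<close>

record ('o, 'm) monoidal_category = "('o, 'm) category" +
  TensorObj :: "'o \<Rightarrow> 'o \<Rightarrow> 'o" (infixr \<open>\<boxtimes>\<index>\<close> 75)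
  Tensor :: "'m \<Rightarrow> 'm \<Rightarrow> 'm" (infixr \<open>\<otimes>\<index>\<close> 75)
  Unit :: 'o (\<open>\<I>\<index>\<close>)
  Assoc :: "'o \<Rightarrow> 'o \<Rightarrow> 'o \<Rightarrow> 'm" (\<open>\<aa>\<index>\<close>)
  LUnit :: "'o \<Rightarrow> 'm" (\<open>\<ll>\<index>\<close>)
  RUnit :: "'o \<Rightarrow> 'm" (\<open>\<rr>\<index>\<close>)

record ('o, 'm) braided_category = "('o, 'm) monoidal_category" +
  Braid :: "'o \<Rightarrow> 'o \<Rightarrow> 'm" (\<open>\<cc>\<index>\<close>)

locale monoidal_category = category C for C (structure) +
  assumes Unit_Obj: "\<I> \<in> Obj C"
    and TensorObj_Obj: "\<lbrakk>A \<in> Obj C; B \<in> Obj C\<rbrakk> \<Longrightarrow> A \<boxtimes> B \<in> Obj C"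
    and Tensor_Hom: "\<lbrakk>f \<in> Hom C A A'; g \<in> Hom C B B'\<rbrakk>
      \<Longrightarrow> f \<otimes> g \<in> Hom C (A \<boxtimes> B) (A' \<boxtimes> B')"
    and Tensor_Ident: "\<lbrakk>A \<in> Obj C; B \<in> Obj C\<rbrakk> \<Longrightarrow> \<ii>\<dd> A \<otimes> \<ii>\<dd> B = \<ii>\<dd> (A \<boxtimes> B)"
    and Tensor_Comp: "\<lbrakk>f \<in> Hom C A A'; f' \<in> Hom C A' A''; g \<in> Hom C B B'; g' \<in> Hom C B' B''\<rbrakk>
      \<Longrightarrow> (f' \<bullet> f) \<otimes> (g' \<bullet> g) = (f' \<otimes> g') \<bullet> (f \<otimes> g)"
    and Assoc_Hom: "\<lbrakk>A \<in> Obj C; B \<in> Obj C; D \<in> Obj C\<rbrakk>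
      \<Longrightarrow> \<aa> A B D \<in> Hom C ((A \<boxtimes> B) \<boxtimes> D) (A \<boxtimes> (B \<boxtimes> D))"
    and Assoc_iso: "\<lbrakk>A \<in> Obj C; B \<in> Obj C; D \<in> Obj C\<rbrakk> \<Longrightarrow> is_iso C (\<aa> A B D)"
    and Assoc_natural: "\<lbrakk>f \<in> Hom C A A'; g \<in> Hom C B B'; h \<in> Hom C D D'\<rbrakk>
      \<Longrightarrow> \<aa> A' B' D' \<bullet> ((f \<otimes> g) \<otimes> h) = (f \<otimes> (g \<otimes> h)) \<bullet> \<aa> A B D"
    and LUnit_Hom: "A \<in> Obj C \<Longrightarrow> \<ll> A \<in> Hom C (\<I> \<boxtimes> A) A"
    and LUnit_iso: "A \<in> Obj C \<Longrightarrow> is_iso C (\<ll> A)"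
    and LUnit_natural: "f \<in> Hom C A B \<Longrightarrow> \<ll> B \<bullet> (\<ii>\<dd> \<I> \<otimes> f) = f \<bullet> \<ll> A"
    and RUnit_Hom: "A \<in> Obj C \<Longrightarrow> \<rr> A \<in> Hom C (A \<boxtimes> \<I>) A"
    and RUnit_iso: "A \<in> Obj C \<Longrightarrow> is_iso C (\<rr> A)"
    and RUnit_natural: "f \<in> Hom C A B \<Longrightarrow> \<rr> B \<bullet> (f \<otimes> \<ii>\<dd> \<I>) = f \<bullet> \<rr> A"
    and triangle: "\<lbrakk>A \<in> Obj C; B \<in> Obj C\<rbrakk>
      \<Longrightarrow> (\<ii>\<dd> A \<otimes> \<ll> B) \<bullet> \<aa> A \<I> B = \<rr> A \<otimes> \<ii>\<dd> B"
    and pentagon: "\<lbrakk>A \<in> Obj C; B \<in> Obj C; D \<in> Obj C; E \<in> Obj C\<rbrakk>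
      \<Longrightarrow> (\<ii>\<dd> A \<otimes> \<aa> B D E) \<bullet> \<aa> A (B \<boxtimes> D) E \<bullet> (\<aa> A B D \<otimes> \<ii>\<dd> E)
        = \<aa> A B (D \<boxtimes> E) \<bullet> \<aa> (A \<boxtimes> B) D E"

text \<open>The two hexagons are independent, as the braiding need not be a symmetry.\<close>

locale braided_category = monoidal_category C for C (structure) +
  assumes Braid_Hom: "\<lbrakk>A \<in> Obj C; B \<in> Obj C\<rbrakk> \<Longrightarrow> \<cc> A B \<in> Hom C (A \<boxtimes> B) (B \<boxtimes> A)"
    and Braid_iso: "\<lbrakk>A \<in> Obj C; B \<in> Obj C\<rbrakk> \<Longrightarrow> is_iso C (\<cc> A B)"
    and Braid_natural: "\<lbrakk>f \<in> Hom C A A'; g \<in> Hom C B B'\<rbrakk>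
      \<Longrightarrow> \<cc> A' B' \<bullet> (f \<otimes> g) = (g \<otimes> f) \<bullet> \<cc> A B"
    and hexagon1: "\<lbrakk>A \<in> Obj C; B \<in> Obj C; D \<in> Obj C\<rbrakk>
      \<Longrightarrow> \<aa> B D A \<bullet> \<cc> A (B \<boxtimes> D) \<bullet> \<aa> A B D
        = (\<ii>\<dd> B \<otimes> \<cc> A D) \<bullet> \<aa> B A D \<bullet> (\<cc> A B \<otimes> \<ii>\<dd> D)"
    and hexagon2: "\<lbrakk>A \<in> Obj C; B \<in> Obj C; D \<in> Obj C\<rbrakk>
      \<Longrightarrow> iso_inv C (\<aa> D A B) \<bullet> \<cc> (A \<boxtimes> B) D \<bullet> iso_inv C (\<aa> A B D)
        = (\<cc> A D \<otimes> \<ii>\<dd> B) \<bullet> iso_inv C (\<aa> A D B) \<bullet> (\<ii>\<dd> A \<otimes> \<cc> B D)"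


section \<open>Subunits and firm categories\<close>

text \<open>
  \<open>subunit\<close> is the predicate on representing monomorphisms; \<open>ISub\<close> consists of the
  subobjects they represent. The defining condition does not depend on the representative.
\<close>

definition subunit :: "('o, 'm, 'z) monoidal_category_scheme \<Rightarrow> 'm \<Rightarrow> bool"
  where "subunit C s \<longleftrightarrow> s \<in> monos_into C \<I>\<^bsub>C\<^esub> \<and> is_iso C (s \<otimes>\<^bsub>C\<^esub> \<ii>\<dd>\<^bsub>C\<^esub> (Dom C s))"

definition ISub :: "('o, 'm, 'z) monoidal_category_scheme \<Rightarrow> 'm set set"
  where "ISub C = subobject_class C ` {s. subunit C s}"

definition ISub_order :: "('o, 'm, 'z) monoidal_category_scheme \<Rightarrow> 'm set gorder"
  where "ISub_order C = \<lparr>carrier = ISub C, eq = (=), le = subobject_le C\<rparr>"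

locale firm_category = braided_category C for C (structure) +
  assumes firm: "\<lbrakk>subunit C s; subunit C t\<rbrakk> \<Longrightarrow> monic C (s \<otimes> \<ii>\<dd> (Dom C t))"

end

theory Submission
  imports Defs
begin

text \<open>
  Let \<open>s\<close> and \<open>t\<close> be subunits with domains \<open>S\<close> and \<open>T\<close>, and let \<open>m = \<ll> \<I> \<bullet> (s \<otimes> t)\<close>.
  Sliding \<open>t\<close> past the left unitor gives \<open>m = t \<bullet> \<ll> T \<bullet> (s \<otimes> T)\<close>. This one factorisation
  yields most of the theorem. It shows \<open>m \<le> t\<close>. It shows that \<open>m\<close> is monic, because \<open>s \<otimes> T\<close> is
  monic by firmness. And it shows that \<open>m \<otimes> (S \<boxtimes> T)\<close> is an isomorphism, because each of
  its three factors becomes invertible after tensoring with \<open>S \<boxtimes> T\<close>: once \<open>f \<otimes> X\<close> is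
  invertible, so are \<open>f \<otimes> (X \<boxtimes> Y)\<close> and \<open>(f \<otimes> Y) \<otimes> X\<close> by naturality of the associator,
  and \<open>f \<otimes> (Y \<boxtimes> X)\<close> by means of the braiding.

  That \<open>m \<le> s\<close> would be the mirror image if the right unitor replaced \<open>\<ll> \<I>\<close>. The two unitors at
  \<open>\<I>\<close> differ at most by an automorphism \<open>u\<close> of \<open>\<I>\<close>, and any such \<open>u\<close> can be moved from the
  left of \<open>s\<close> to its right, where it becomes \<open>u \<otimes> S\<close> up to unitors.

  Finally, \<open>m\<close> is the greatest lower bound because subunits are idempotent. If a subunit \<open>r\<close> with
  domain \<open>R\<close> equals both \<open>s \<bullet> f\<close> and \<open>t \<bullet> g\<close>, then
  \<open>r \<bullet> \<ll> R \<bullet> (r \<otimes> R) = \<ll> \<I> \<bullet> (r \<otimes> r) = m \<bullet> (f \<otimes> g)\<close>, and the isomorphism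
  \<open>\<ll> R \<bullet> (r \<otimes> R)\<close> can be moved to the other side.
\<close>

section \<open>Isomorphisms, monomorphisms and factorisations\<close>

context category
begin

lemma HomD:
  assumes "f \<in> Hom C A B"
  shows "f \<in> Arr C" "Dom C f = A" "Cod C f = B" "A \<in> Obj C" "B \<in> Obj C"
  using assms Dom_Obj Cod_Obj by (auto simp: Hom_def)

lemma is_isoI:
  assumes "f \<in> Hom C A B" "g \<in> Hom C B A" "g \<bullet> f = \<ii>\<dd> A" "f \<bullet> g = \<ii>\<dd> B"
  shows "is_iso C f"
  using assms HomD[OF assms(1)] by (auto simp: is_iso_def inverse_arrows_def)

lemma is_isoE:
  assumes "is_iso C f" "f \<in> Hom C A B"
  obtains g where "g \<in> Hom C B A" "g \<bullet> f = \<ii>\<dd> A" "f \<bullet> g = \<ii>\<dd> B"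
  using assms HomD[OF assms(2)] by (auto simp: is_iso_def inverse_arrows_def)

lemma is_iso_Ident: "A \<in> Obj C \<Longrightarrow> is_iso C (\<ii>\<dd> A)"
  using Comp_Ident_left Ident_Hom is_isoI by metis

lemma is_iso_Comp:
  assumes f: "f \<in> Hom C A B" "is_iso C f" and g: "g \<in> Hom C B D" "is_iso C g"
  shows "is_iso C (g \<bullet> f)"
proof -
  obtain f' where f': "f' \<in> Hom C B A" "f' \<bullet> f = \<ii>\<dd> A" "f \<bullet> f' = \<ii>\<dd> B"
    using f is_isoE by metis
  obtain g' where g': "g' \<in> Hom C D B" "g' \<bullet> g = \<ii>\<dd> B" "g \<bullet> g' = \<ii>\<dd> D"
    using g is_isoE by metis
  show ?thesis
  proof (rule is_isoI)
    show gf: "g \<bullet> f \<in> Hom C A D" and fg: "f' \<bullet> g' \<in> Hom C D A"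
      using f g f' g' Comp_Hom by metis+
    have "(f' \<bullet> g') \<bullet> (g \<bullet> f) = f' \<bullet> ((g' \<bullet> g) \<bullet> f)"
      using Comp_assoc[OF gf g'(1) f'(1)] Comp_assoc[OF f(1) g(1) g'(1)] by simp
    then show "(f' \<bullet> g') \<bullet> (g \<bullet> f) = \<ii>\<dd> A"
      using f f' g' Comp_Ident_left by metis
    have "(g \<bullet> f) \<bullet> (f' \<bullet> g') = g \<bullet> ((f \<bullet> f') \<bullet> g')"
      using Comp_assoc[OF fg f(1) g(1)] Comp_assoc[OF g'(1) f'(1) f(1)] by simp
    then show "(g \<bullet> f) \<bullet> (f' \<bullet> g') = \<ii>\<dd> D"
      using g f' g' Comp_Ident_left by metis
  qed
qed

lemma solve_iso_right:
  assumes e: "e \<in> Hom C A B" "is_iso C e" and x: "x \<in> Hom C B D" and eq: "x \<bullet> e = y"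
  obtains e' where "e' \<in> Hom C B A" "is_iso C e'" "x = y \<bullet> e'"
proof -
  obtain e' where e': "e' \<in> Hom C B A" "e' \<bullet> e = \<ii>\<dd> A" "e \<bullet> e' = \<ii>\<dd> B"
    using e is_isoE by metis
  have "y \<bullet> e' = x"
    using Comp_assoc[OF e'(1) e(1) x] eq e'(3) Comp_Ident_right[OF x] by simp
  then show thesis
    using that e' e is_isoI by metis
qed

text \<open>This is how invertibility is carried along a naturality square of the associator, or along the
  square that interchanges \<open>f\<close> with a braiding in the other tensor factor.\<close>

lemma is_iso_square:
  assumes a: "a \<in> Hom C A B" and b: "b \<in> Hom C A' B'"
    and p: "p \<in> Hom C A A'" "is_iso C p" and q: "q \<in> Hom C B B'" "is_iso C q"
    and sq: "q \<bullet> a = b \<bullet> p"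
  shows "is_iso C a \<longleftrightarrow> is_iso C b"
proof
  assume "is_iso C a"
  then have "is_iso C (q \<bullet> a)"
    using a q is_iso_Comp by blast
  moreover obtain p' where "p' \<in> Hom C A' A" "is_iso C p'" "b = (q \<bullet> a) \<bullet> p'"
    using solve_iso_right[OF p b sq[symmetric]] by metis
  ultimately show "is_iso C b"
    using a q Comp_Hom is_iso_Comp by metis
next
  assume "is_iso C b"
  then have bp: "is_iso C (b \<bullet> p)"
    using b p is_iso_Comp by blast
  obtain q' where q': "q' \<in> Hom C B' B" "q' \<bullet> q = \<ii>\<dd> B" "q \<bullet> q' = \<ii>\<dd> B'"
    using q is_isoE by metis
  have "a = q' \<bullet> (b \<bullet> p)"
    using Comp_assoc[OF a q(1) q'(1)] sq q'(2) Comp_Ident_left[OF a] by simp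
  moreover have "is_iso C q'"
    using q' q is_isoI by metis
  ultimately show "is_iso C a"
    using bp is_iso_Comp[OF _ bp q'(1)] b p Comp_Hom by metis
qed

lemma monicD:
  assumes "monic C m" "m \<in> Hom C A B" "f \<in> Hom C X A" "g \<in> Hom C X A" "m \<bullet> f = m \<bullet> g"
  shows "f = g"
  using assms HomD[OF assms(2)] HomD[OF assms(3)] by (auto simp: monic_def)

lemma monicI:
  assumes "m \<in> Hom C A B"
    and "\<And>X f g. \<lbrakk>f \<in> Hom C X A; g \<in> Hom C X A; m \<bullet> f = m \<bullet> g\<rbrakk> \<Longrightarrow> f = g"
  shows "monic C m"
  using assms HomD[OF assms(1)] by (auto simp: monic_def)

lemma monic_Comp:
  assumes f: "f \<in> Hom C A B" "monic C f" and g: "g \<in> Hom C B D" "monic C g"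
  shows "monic C (g \<bullet> f)"
proof (rule monicI)
  show "g \<bullet> f \<in> Hom C A D"
    using f g Comp_Hom by blast
  fix X h k
  assume h: "h \<in> Hom C X A" and k: "k \<in> Hom C X A" and "(g \<bullet> f) \<bullet> h = (g \<bullet> f) \<bullet> k"
  then have "g \<bullet> (f \<bullet> h) = g \<bullet> (f \<bullet> k)"
    using Comp_assoc f g by metis
  then have "f \<bullet> h = f \<bullet> k"
    using monicD[OF g(2,1)] h k f Comp_Hom by metis
  then show "h = k"
    using monicD[OF f(2,1)] h k by metis
qed

lemma is_iso_monic:
  assumes f: "f \<in> Hom C A B" "is_iso C f"
  shows "monic C f"
proof -
  obtain g where g: "g \<in> Hom C B A" "g \<bullet> f = \<ii>\<dd> A"
    using f is_isoE by metis
  show ?thesis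
  proof (rule monicI[OF f(1)])
    fix X h k
    assume h: "h \<in> Hom C X A" and k: "k \<in> Hom C X A" and eq: "f \<bullet> h = f \<bullet> k"
    show "h = k"
      using Comp_assoc[OF h f(1) g(1)] Comp_assoc[OF k f(1) g(1)] eq g(2)
        Comp_Ident_left[OF h] Comp_Ident_left[OF k] by simp
  qed
qed

lemma factors_throughI:
  assumes "s \<in> Hom C S X" "t \<in> Hom C T X" "h \<in> Hom C S T" "s = t \<bullet> h"
  shows "factors_through C s t"
  using assms HomD by (metis factors_through_def)

lemma factors_through_refl:
  assumes "s \<in> Arr C"
  shows "factors_through C s s"
proof -
  have s: "s \<in> Hom C (Dom C s) (Cod C s)"
    using assms by (simp add: Hom_def)
  show ?thesis
    using factors_throughI[OF s s] Ident_Hom Comp_Ident_right[OF s] HomD[OF s] by metis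
qed

lemma factors_through_trans:
  assumes "factors_through C r s" "factors_through C s t" "t \<in> Arr C"
  shows "factors_through C r t"
proof -
  obtain h k where h: "h \<in> Hom C (Dom C r) (Dom C s)" "r = s \<bullet> h"
    and k: "k \<in> Hom C (Dom C s) (Dom C t)" "s = t \<bullet> k"
    using assms by (auto simp: factors_through_def)
  have t: "t \<in> Hom C (Dom C t) (Cod C t)"
    using assms by (simp add: Hom_def)
  have "r = t \<bullet> (k \<bullet> h)"
    using h(2) k(2) Comp_assoc[OF h(1) k(1) t] by simp
  then show ?thesis
    using Comp_Hom[OF h(1) k(1)] by (auto simp: factors_through_def)
qed

lemma monos_into_Hom: "s \<in> monos_into C X \<Longrightarrow> s \<in> Hom C (Dom C s) X"
  by (auto simp: monos_into_def monic_def Hom_def)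

lemma mem_subobject_class_iff:
  assumes "s \<in> monos_into C X"
  shows "s' \<in> subobject_class C s \<longleftrightarrow>
    s' \<in> monos_into C X \<and> factors_through C s s' \<and> factors_through C s' s"
  using assms by (auto simp: subobject_class_def subobject_rel_def monos_into_def)

text \<open>Comparing subobjects through some pair of representatives agrees with comparing them
  through any given pair.\<close>

lemma subobject_le_class_iff:
  assumes s: "s \<in> monos_into C X" and t: "t \<in> monos_into C X"
  shows "subobject_le C (subobject_class C s) (subobject_class C t) \<longleftrightarrow> factors_through C s t"
proof
  assume "subobject_le C (subobject_class C s) (subobject_class C t)"
  then obtain s' t' where "factors_through C s s'" "factors_through C s' t'"
    "factors_through C t' t" "t' \<in> monos_into C X"
    using s t mem_subobject_class_iff by (metis subobject_le_def)
  then show "factors_through C s t"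
    using t monos_into_Hom HomD(1) factors_through_trans by metis
next
  assume "factors_through C s t"
  moreover have "s \<in> subobject_class C s" "t \<in> subobject_class C t"
    using s t mem_subobject_class_iff monos_into_Hom HomD(1) factors_through_refl by metis+
  ultimately show "subobject_le C (subobject_class C s) (subobject_class C t)"
    by (auto simp: subobject_le_def)
qed

lemma subobject_class_eqI:
  assumes "s \<in> monos_into C X" "t \<in> monos_into C X" "factors_through C s t" "factors_through C t s"
  shows "subobject_class C s = subobject_class C t"
proof -
  have "s' \<in> subobject_class C s \<longleftrightarrow> s' \<in> subobject_class C t" for s'
    unfolding mem_subobject_class_iff[OF assms(1)] mem_subobject_class_iff[OF assms(2)]
    using assms monos_into_Hom HomD(1) factors_through_trans by metis
  then show ?thesis
    by blast
qed

end

section \<open>Arrows that become invertible after tensoring\<close>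

context monoidal_category
begin

lemma Tensor_split:
  assumes f: "f \<in> Hom C A A'" and g: "g \<in> Hom C B B'"
  shows "f \<otimes> g = (\<ii>\<dd> A' \<otimes> g) \<bullet> (f \<otimes> \<ii>\<dd> B)" "f \<otimes> g = (f \<otimes> \<ii>\<dd> B') \<bullet> (\<ii>\<dd> A \<otimes> g)"
proof -
  show "f \<otimes> g = (\<ii>\<dd> A' \<otimes> g) \<bullet> (f \<otimes> \<ii>\<dd> B)"
    using Tensor_Comp[OF f Ident_Hom Ident_Hom g] Comp_Ident_left[OF f] Comp_Ident_right[OF g]
      HomD[OF f] HomD[OF g] by simp
  show "f \<otimes> g = (f \<otimes> \<ii>\<dd> B') \<bullet> (\<ii>\<dd> A \<otimes> g)"
    using Tensor_Comp[OF Ident_Hom f g Ident_Hom] Comp_Ident_right[OF f] Comp_Ident_left[OF g]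
      HomD[OF f] HomD[OF g] by simp
qed

lemma Comp_Tensor_Ident:
  assumes "f \<in> Hom C A B" "g \<in> Hom C B D" "X \<in> Obj C"
  shows "(g \<bullet> f) \<otimes> \<ii>\<dd> X = (g \<otimes> \<ii>\<dd> X) \<bullet> (f \<otimes> \<ii>\<dd> X)"
  using Tensor_Comp[OF assms(1,2) Ident_Hom Ident_Hom] Comp_Ident_left[OF Ident_Hom] assms(3)
  by simp

lemma is_iso_Tensor:
  assumes f: "f \<in> Hom C A A'" "is_iso C f" and g: "g \<in> Hom C B B'" "is_iso C g"
  shows "is_iso C (f \<otimes> g)"
proof -
  obtain f' where f': "f' \<in> Hom C A' A" "f' \<bullet> f = \<ii>\<dd> A" "f \<bullet> f' = \<ii>\<dd> A'"
    using f is_isoE by metis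
  obtain g' where g': "g' \<in> Hom C B' B" "g' \<bullet> g = \<ii>\<dd> B" "g \<bullet> g' = \<ii>\<dd> B'"
    using g is_isoE by metis
  show ?thesis
  proof (rule is_isoI)
    show "f \<otimes> g \<in> Hom C (A \<boxtimes> B) (A' \<boxtimes> B')" "f' \<otimes> g' \<in> Hom C (A' \<boxtimes> B') (A \<boxtimes> B)"
      using f g f' g' Tensor_Hom by auto
    show "(f' \<otimes> g') \<bullet> (f \<otimes> g) = \<ii>\<dd> (A \<boxtimes> B)"
      using Tensor_Comp[OF f(1) f'(1) g(1) g'(1)] f' g' Tensor_Ident HomD[OF f(1)] HomD[OF g(1)]
      by simp
    show "(f \<otimes> g) \<bullet> (f' \<otimes> g') = \<ii>\<dd> (A' \<boxtimes> B')"
      using Tensor_Comp[OF f'(1) f(1) g'(1) g(1)] f' g' Tensor_Ident HomD[OF f(1)] HomD[OF g(1)]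
      by simp
  qed
qed

lemma is_iso_Tensor_assoc:
  assumes f: "f \<in> Hom C A B" and X: "X \<in> Obj C" and Y: "Y \<in> Obj C"
  shows "is_iso C ((f \<otimes> \<ii>\<dd> X) \<otimes> \<ii>\<dd> Y) \<longleftrightarrow> is_iso C (f \<otimes> \<ii>\<dd> (X \<boxtimes> Y))"
proof (rule is_iso_square)
  note obj = HomD(4,5)[OF f] X Y
  show "(f \<otimes> \<ii>\<dd> X) \<otimes> \<ii>\<dd> Y \<in> Hom C ((A \<boxtimes> X) \<boxtimes> Y) ((B \<boxtimes> X) \<boxtimes> Y)"
    and "f \<otimes> \<ii>\<dd> (X \<boxtimes> Y) \<in> Hom C (A \<boxtimes> (X \<boxtimes> Y)) (B \<boxtimes> (X \<boxtimes> Y))"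
    using f X Y by (auto intro!: Tensor_Hom Ident_Hom TensorObj_Obj)
  show "\<aa> A X Y \<in> Hom C ((A \<boxtimes> X) \<boxtimes> Y) (A \<boxtimes> (X \<boxtimes> Y))" "is_iso C (\<aa> A X Y)"
    and "\<aa> B X Y \<in> Hom C ((B \<boxtimes> X) \<boxtimes> Y) (B \<boxtimes> (X \<boxtimes> Y))" "is_iso C (\<aa> B X Y)"
    using obj Assoc_Hom Assoc_iso by auto
  show "\<aa> B X Y \<bullet> ((f \<otimes> \<ii>\<dd> X) \<otimes> \<ii>\<dd> Y) = (f \<otimes> \<ii>\<dd> (X \<boxtimes> Y)) \<bullet> \<aa> A X Y"
    using Assoc_natural[OF f Ident_Hom[OF X] Ident_Hom[OF Y]] Tensor_Ident[OF X Y] by simp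
qed

lemma is_iso_Tensor_TensorObj_left:
  assumes f: "f \<in> Hom C A B" and X: "X \<in> Obj C" and Y: "Y \<in> Obj C"
    and iso: "is_iso C (f \<otimes> \<ii>\<dd> X)"
  shows "is_iso C (f \<otimes> \<ii>\<dd> (X \<boxtimes> Y))"
  using is_iso_Tensor_assoc[OF f X Y] is_iso_Tensor iso is_iso_Ident Ident_Hom Tensor_Hom f X Y
  by metis

text \<open>Naturality of the right unitor gives such a factorisation of \<open>\<rr> \<I> \<bullet> (s \<otimes> \<I>)\<close>. The left
  unitor at \<open>\<I>\<close> is \<open>u \<bullet> \<rr> \<I>\<close> for some \<open>u\<close>, and \<open>u \<bullet> s\<close> factors through \<open>s\<close> because
  \<open>u \<otimes> \<I>\<close> and \<open>\<I> \<otimes> s\<close> commute by interchange.\<close>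

lemma LUnit_Tensor_Unit_factors:
  assumes s: "s \<in> Hom C S \<I>"
  obtains w where "w \<in> Hom C (S \<boxtimes> \<I>) S" "\<ll> \<I> \<bullet> (s \<otimes> \<ii>\<dd> \<I>) = s \<bullet> w"
proof -
  note S = HomD(4)[OF s]
  note I = Unit_Obj
  note iI = Ident_Hom[OF I]
  note sI = Tensor_Hom[OF s iI] and Is = Tensor_Hom[OF iI s]
  obtain u where u: "u \<in> Hom C \<I> \<I>" "\<ll> \<I> = u \<bullet> \<rr> \<I>"
  proof -
    obtain r' where "r' \<in> Hom C \<I> (\<I> \<boxtimes> \<I>)" "r' \<bullet> \<rr> \<I> = \<ii>\<dd> (\<I> \<boxtimes> \<I>)"
      using RUnit_iso[OF I] RUnit_Hom[OF I] is_isoE by metis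
    then show thesis
      using that[of "\<ll> \<I> \<bullet> r'"] LUnit_Hom[OF I] RUnit_Hom[OF I] Comp_Hom Comp_assoc
        Comp_Ident_right by metis
  qed
  note uI = Tensor_Hom[OF u(1) iI] and uS = Tensor_Hom[OF u(1) Ident_Hom[OF S]]
  have u_slide: "\<ll> \<I> \<bullet> (u \<otimes> \<ii>\<dd> \<I>) = u \<bullet> \<ll> \<I>"
    using Comp_assoc[OF uI RUnit_Hom[OF I] u(1)] RUnit_natural[OF u(1)] u(2) by simp
  \<comment> \<open>Both sides below are \<open>\<ll> \<I> \<bullet> (u \<otimes> s)\<close>.\<close>
  have us: "(u \<bullet> s) \<bullet> \<ll> S = s \<bullet> (\<ll> S \<bullet> (u \<otimes> \<ii>\<dd> S))"
  proof -
    have "(u \<bullet> s) \<bullet> \<ll> S = u \<bullet> (\<ll> \<I> \<bullet> (\<ii>\<dd> \<I> \<otimes> s))"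
      using Comp_assoc[OF LUnit_Hom[OF S] s u(1)] LUnit_natural[OF s] by simp
    also have "\<dots> = \<ll> \<I> \<bullet> ((u \<otimes> \<ii>\<dd> \<I>) \<bullet> (\<ii>\<dd> \<I> \<otimes> s))"
      using Comp_assoc[OF Is LUnit_Hom[OF I] u(1)] u_slide Comp_assoc[OF Is uI LUnit_Hom[OF I]]
      by simp
    also have "\<dots> = \<ll> \<I> \<bullet> ((\<ii>\<dd> \<I> \<otimes> s) \<bullet> (u \<otimes> \<ii>\<dd> S))"
      using Tensor_split[OF u(1) s] by simp
    also have "\<dots> = (s \<bullet> \<ll> S) \<bullet> (u \<otimes> \<ii>\<dd> S)"
      using Comp_assoc[OF uS Is LUnit_Hom[OF I]] LUnit_natural[OF s] by simp
    also have "\<dots> = s \<bullet> (\<ll> S \<bullet> (u \<otimes> \<ii>\<dd> S))"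
      using Comp_assoc[OF uS LUnit_Hom[OF S] s] .
    finally show ?thesis .
  qed
  note lu = Comp_Hom[OF uS LUnit_Hom[OF S]]
  obtain l' where l': "l' \<in> Hom C S (\<I> \<boxtimes> S)" "u \<bullet> s = (s \<bullet> (\<ll> S \<bullet> (u \<otimes> \<ii>\<dd> S))) \<bullet> l'"
    using solve_iso_right[OF LUnit_Hom[OF S] LUnit_iso[OF S] Comp_Hom[OF s u(1)] us] by metis
  define v where "v = (\<ll> S \<bullet> (u \<otimes> \<ii>\<dd> S)) \<bullet> l'"
  have v: "v \<in> Hom C S S" "u \<bullet> s = s \<bullet> v"
    using Comp_Hom[OF l'(1) lu] Comp_assoc[OF l'(1) lu s] l'(2) by (simp_all add: v_def)
  have "\<ll> \<I> \<bullet> (s \<otimes> \<ii>\<dd> \<I>) = u \<bullet> (s \<bullet> \<rr> S)"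
    using Comp_assoc[OF sI RUnit_Hom[OF I] u(1)] RUnit_natural[OF s] u(2) by simp
  also have "\<dots> = s \<bullet> (v \<bullet> \<rr> S)"
    using Comp_assoc[OF RUnit_Hom[OF S] s u(1)] v(2) Comp_assoc[OF RUnit_Hom[OF S] v(1) s] by simp
  finally show thesis
    using that Comp_Hom[OF RUnit_Hom[OF S] v(1)] by blast
qed

end

context braided_category
begin

text \<open>The braiding swaps \<open>X\<close> and \<open>Y\<close>, which reduces this to the case of \<open>f \<otimes> (Y \<boxtimes> X)\<close>.\<close>

lemma is_iso_Tensor_TensorObj_right:
  assumes f: "f \<in> Hom C A B" and X: "X \<in> Obj C" and Y: "Y \<in> Obj C"
    and iso: "is_iso C (f \<otimes> \<ii>\<dd> Y)"
  shows "is_iso C (f \<otimes> \<ii>\<dd> (X \<boxtimes> Y))"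
proof -
  note obj = HomD(4,5)[OF f] X Y
  note c = Braid_Hom[OF X Y]
  have "is_iso C (f \<otimes> \<ii>\<dd> (X \<boxtimes> Y)) \<longleftrightarrow> is_iso C (f \<otimes> \<ii>\<dd> (Y \<boxtimes> X))"
  proof (rule is_iso_square)
    show "f \<otimes> \<ii>\<dd> (X \<boxtimes> Y) \<in> Hom C (A \<boxtimes> (X \<boxtimes> Y)) (B \<boxtimes> (X \<boxtimes> Y))"
      and "f \<otimes> \<ii>\<dd> (Y \<boxtimes> X) \<in> Hom C (A \<boxtimes> (Y \<boxtimes> X)) (B \<boxtimes> (Y \<boxtimes> X))"
      using f X Y by (auto intro!: Tensor_Hom Ident_Hom TensorObj_Obj)
    show "\<ii>\<dd> A \<otimes> \<cc> X Y \<in> Hom C (A \<boxtimes> (X \<boxtimes> Y)) (A \<boxtimes> (Y \<boxtimes> X))"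
      and "\<ii>\<dd> B \<otimes> \<cc> X Y \<in> Hom C (B \<boxtimes> (X \<boxtimes> Y)) (B \<boxtimes> (Y \<boxtimes> X))"
      using obj c by (auto intro: Tensor_Hom Ident_Hom)
    show "is_iso C (\<ii>\<dd> A \<otimes> \<cc> X Y)" "is_iso C (\<ii>\<dd> B \<otimes> \<cc> X Y)"
      using obj c Braid_iso is_iso_Tensor is_iso_Ident Ident_Hom by metis+
    show "(\<ii>\<dd> B \<otimes> \<cc> X Y) \<bullet> (f \<otimes> \<ii>\<dd> (X \<boxtimes> Y)) = (f \<otimes> \<ii>\<dd> (Y \<boxtimes> X)) \<bullet> (\<ii>\<dd> A \<otimes> \<cc> X Y)"
      using Tensor_split[OF f c] by simp
  qed
  then show ?thesis
    using is_iso_Tensor_TensorObj_left[OF f Y X iso] by blast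
qed

end

section \<open>Subunits and their meets\<close>

context monoidal_category
begin

lemma subunitD:
  assumes "subunit C s"
  shows "s \<in> monos_into C \<I>" "s \<in> Hom C (Dom C s) \<I>" "monic C s" "Dom C s \<in> Obj C"
    "is_iso C (s \<otimes> \<ii>\<dd> (Dom C s))"
proof -
  show s: "s \<in> monos_into C \<I>" and "is_iso C (s \<otimes> \<ii>\<dd> (Dom C s))"
    using assms by (simp_all add: subunit_def)
  show "monic C s"
    using s by (simp add: monos_into_def)
  show "s \<in> Hom C (Dom C s) \<I>"
    using s by (rule monos_into_Hom)
  then show "Dom C s \<in> Obj C"
    by (rule HomD(4))
qed

lemma subunit_Ident_Unit: "subunit C (\<ii>\<dd> \<I>)"
proof -
  note iI = Ident_Hom[OF Unit_Obj]
  have "is_iso C (\<ii>\<dd> \<I> \<otimes> \<ii>\<dd> \<I>)"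
    using is_iso_Tensor iI is_iso_Ident[OF Unit_Obj] by metis
  moreover have "monic C (\<ii>\<dd> \<I>)"
    using is_iso_monic[OF iI is_iso_Ident[OF Unit_Obj]] .
  ultimately show ?thesis
    using HomD[OF iI] by (simp add: subunit_def monos_into_def)
qed

lemma LUnit_Tensor_eq_Comp_right:
  assumes s: "s \<in> Hom C S \<I>" and t: "t \<in> Hom C T \<I>"
  shows "\<ll> \<I> \<bullet> (s \<otimes> t) = t \<bullet> (\<ll> T \<bullet> (s \<otimes> \<ii>\<dd> T))"
proof -
  note T = HomD(4)[OF t]
  note sT = Tensor_Hom[OF s Ident_Hom[OF T]] and It = Tensor_Hom[OF Ident_Hom[OF Unit_Obj] t]
  show ?thesis
    using Tensor_split(1)[OF s t] Comp_assoc[OF sT It LUnit_Hom[OF Unit_Obj]]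
      LUnit_natural[OF t] Comp_assoc[OF sT LUnit_Hom[OF T] t] by simp
qed

lemma LUnit_Tensor_factors_through_left:
  assumes s: "s \<in> Hom C S \<I>" and t: "t \<in> Hom C T \<I>"
  shows "factors_through C (\<ll> \<I> \<bullet> (s \<otimes> t)) s"
proof -
  note I = Unit_Obj
  note st = Tensor_Hom[OF s t] and sI = Tensor_Hom[OF s Ident_Hom[OF I]]
    and St = Tensor_Hom[OF Ident_Hom[OF HomD(4)[OF s]] t]
  obtain w where w: "w \<in> Hom C (S \<boxtimes> \<I>) S" "\<ll> \<I> \<bullet> (s \<otimes> \<ii>\<dd> \<I>) = s \<bullet> w"
    using LUnit_Tensor_Unit_factors[OF s] by metis
  have "\<ll> \<I> \<bullet> (s \<otimes> t) = s \<bullet> (w \<bullet> (\<ii>\<dd> S \<otimes> t))"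
    using Tensor_split(2)[OF s t] Comp_assoc[OF St sI LUnit_Hom[OF I]] w(2)
      Comp_assoc[OF St w(1) s] by simp
  then show ?thesis
    using factors_throughI[OF Comp_Hom[OF st LUnit_Hom[OF I]] s Comp_Hom[OF St w(1)]] by blast
qed

lemma LUnit_Tensor_factors_through_right:
  assumes s: "s \<in> Hom C S \<I>" and t: "t \<in> Hom C T \<I>"
  shows "factors_through C (\<ll> \<I> \<bullet> (s \<otimes> t)) t"
proof -
  note T = HomD(4)[OF t]
  note st = Tensor_Hom[OF s t] and sT = Tensor_Hom[OF s Ident_Hom[OF T]]
  show ?thesis
    using factors_throughI[OF Comp_Hom[OF st LUnit_Hom[OF Unit_Obj]] t
        Comp_Hom[OF sT LUnit_Hom[OF T]] LUnit_Tensor_eq_Comp_right[OF s t]] .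
qed

text \<open>Tensoring the factorisations of \<open>r\<close> through \<open>s\<close> and through \<open>t\<close> factors \<open>r \<otimes> r\<close>
  through \<open>s \<otimes> t\<close>. As \<open>r\<close> is a subunit, \<open>r \<otimes> r\<close> is just \<open>r\<close> up to an isomorphism of
  domains and \<open>\<ll> \<I>\<close>.\<close>

lemma subunit_factors_through_LUnit_Tensor:
  assumes r: "subunit C r" and s: "s \<in> Hom C S \<I>" and t: "t \<in> Hom C T \<I>"
    and rs: "factors_through C r s" and rt: "factors_through C r t"
  shows "factors_through C r (\<ll> \<I> \<bullet> (s \<otimes> t))"
proof -
  let ?R = "Dom C r"
  note r' = subunitD(2)[OF r] and R = subunitD(4)[OF r] and lI = LUnit_Hom[OF Unit_Obj]
  note rR = Tensor_Hom[OF r' Ident_Hom[OF R]] and st = Tensor_Hom[OF s t]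
  obtain f where f: "f \<in> Hom C ?R S" "r = s \<bullet> f"
    using rs HomD[OF s] by (auto simp: factors_through_def)
  obtain g where g: "g \<in> Hom C ?R T" "r = t \<bullet> g"
    using rt HomD[OF t] by (auto simp: factors_through_def)
  note fg = Tensor_Hom[OF f(1) g(1)]
  have "r \<bullet> (\<ll> ?R \<bullet> (r \<otimes> \<ii>\<dd> ?R)) = \<ll> \<I> \<bullet> (r \<otimes> r)"
    using LUnit_Tensor_eq_Comp_right[OF r' r'] by simp
  also have "r \<otimes> r = (s \<otimes> t) \<bullet> (f \<otimes> g)"
    using Tensor_Comp[OF f(1) s g(1) t] f(2) g(2) by metis
  also have "\<ll> \<I> \<bullet> ((s \<otimes> t) \<bullet> (f \<otimes> g)) = (\<ll> \<I> \<bullet> (s \<otimes> t)) \<bullet> (f \<otimes> g)"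
    using Comp_assoc[OF fg st lI] by simp
  finally have eq: "r \<bullet> (\<ll> ?R \<bullet> (r \<otimes> \<ii>\<dd> ?R)) = (\<ll> \<I> \<bullet> (s \<otimes> t)) \<bullet> (f \<otimes> g)" .
  note e = Comp_Hom[OF rR LUnit_Hom[OF R]]
  have e_iso: "is_iso C (\<ll> ?R \<bullet> (r \<otimes> \<ii>\<dd> ?R))"
    using is_iso_Comp[OF rR subunitD(5)[OF r] LUnit_Hom[OF R] LUnit_iso[OF R]] .
  obtain e' where e': "e' \<in> Hom C ?R (?R \<boxtimes> ?R)"
    "r = ((\<ll> \<I> \<bullet> (s \<otimes> t)) \<bullet> (f \<otimes> g)) \<bullet> e'"
    using solve_iso_right[OF e e_iso r' eq] by metis
  have "r = (\<ll> \<I> \<bullet> (s \<otimes> t)) \<bullet> ((f \<otimes> g) \<bullet> e')"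
    using Comp_assoc[OF e'(1) fg Comp_Hom[OF st lI]] e'(2) by simp
  then show ?thesis
    using factors_throughI[OF r' Comp_Hom[OF st lI] Comp_Hom[OF e'(1) fg]] by blast
qed

lemma ISub_order_simps:
  "carrier (ISub_order C) = ISub C" "(.=\<^bsub>ISub_order C\<^esub>) = (=)"
  "(\<sqsubseteq>\<^bsub>ISub_order C\<^esub>) = subobject_le C"
  by (simp_all add: ISub_order_def)

lemma ISub_orderE:
  assumes "x \<in> carrier (ISub_order C)"
  obtains s where "subunit C s" "x = subobject_class C s"
  using assms by (auto simp: ISub_order_def ISub_def)

lemma ISub_order_le_iff:
  assumes "subunit C s" "subunit C t"
  shows "subobject_class C s \<sqsubseteq>\<^bsub>ISub_order C\<^esub> subobject_class C t \<longleftrightarrow> factors_through C s t"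
  using subobject_le_class_iff subunitD(1) assms by (metis ISub_order_simps(3))

lemma subobject_class_in_ISub_order:
  "subunit C s \<Longrightarrow> subobject_class C s \<in> carrier (ISub_order C)"
  by (simp add: ISub_order_def ISub_def)

lemma partial_order_ISub_order: "partial_order (ISub_order C)"
proof
  fix x assume "x \<in> carrier (ISub_order C)"
  then show "x \<sqsubseteq>\<^bsub>ISub_order C\<^esub> x"
    using ISub_orderE ISub_order_le_iff factors_through_refl subunitD(2) HomD(1) by metis
next
  fix x y
  assume le: "x \<sqsubseteq>\<^bsub>ISub_order C\<^esub> y" "y \<sqsubseteq>\<^bsub>ISub_order C\<^esub> x"
    and x: "x \<in> carrier (ISub_order C)" and y: "y \<in> carrier (ISub_order C)"
  obtain s where s: "subunit C s" "x = subobject_class C s" using x ISub_orderE by metis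
  obtain t where t: "subunit C t" "y = subobject_class C t" using y ISub_orderE by metis
  show "x .=\<^bsub>ISub_order C\<^esub> y"
    using subobject_class_eqI[OF subunitD(1)[OF s(1)] subunitD(1)[OF t(1)]] le
      ISub_order_le_iff[OF s(1) t(1)] ISub_order_le_iff[OF t(1) s(1)] s(2) t(2)
    by (simp add: ISub_order_simps(2))
next
  fix x y z
  assume le: "x \<sqsubseteq>\<^bsub>ISub_order C\<^esub> y" "y \<sqsubseteq>\<^bsub>ISub_order C\<^esub> z"
    and x: "x \<in> carrier (ISub_order C)" and y: "y \<in> carrier (ISub_order C)"
    and z: "z \<in> carrier (ISub_order C)"
  obtain r where r: "subunit C r" "x = subobject_class C r" using x ISub_orderE by metis
  obtain s where s: "subunit C s" "y = subobject_class C s" using y ISub_orderE by metis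
  obtain t where t: "subunit C t" "z = subobject_class C t" using z ISub_orderE by metis
  show "x \<sqsubseteq>\<^bsub>ISub_order C\<^esub> z"
    using factors_through_trans[OF _ _ HomD(1)[OF subunitD(2)[OF t(1)]]] le
      ISub_order_le_iff[OF r(1) s(1)] ISub_order_le_iff[OF s(1) t(1)]
      ISub_order_le_iff[OF r(1) t(1)] r(2) s(2) t(2) by simp
qed (auto simp: ISub_order_simps)

lemma greatest_ISub_order_Unit:
  "greatest (ISub_order C) (subobject_class C (\<ii>\<dd> \<I>)) (carrier (ISub_order C))"
proof -
  have "factors_through C s (\<ii>\<dd> \<I>)" if "subunit C s" for s
    using factors_throughI subunitD(2)[OF that] Ident_Hom[OF Unit_Obj] Comp_Ident_left by metis
  then have "x \<sqsubseteq>\<^bsub>ISub_order C\<^esub> subobject_class C (\<ii>\<dd> \<I>)" if "x \<in> carrier (ISub_order C)" for x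
    using that ISub_orderE ISub_order_le_iff subunit_Ident_Unit by metis
  then show ?thesis
    using subobject_class_in_ISub_order[OF subunit_Ident_Unit] by (auto simp: greatest_def)
qed

end

context firm_category
begin

text \<open>The factorisation \<open>t \<bullet> \<ll> T \<bullet> (s \<otimes> T)\<close> presents the arrow as a composite of three monos, the
  last by firmness, each of which is inverted by tensoring with \<open>S \<boxtimes> T\<close>.\<close>

lemma subunit_tensor:
  assumes s: "subunit C s" and t: "subunit C t"
  shows "subunit C (\<ll> \<I> \<bullet> (s \<otimes> t))"
proof -
  let ?S = "Dom C s" and ?T = "Dom C t"
  let ?P = "?S \<boxtimes> ?T"
  note s' = subunitD(2)[OF s] and t' = subunitD(2)[OF t]
    and S = subunitD(4)[OF s] and T = subunitD(4)[OF t]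
  note P = TensorObj_Obj[OF S T]
  note iP = Ident_Hom[OF P]
  note sT = Tensor_Hom[OF s' Ident_Hom[OF T]] and l = LUnit_Hom[OF T]
  note lsT = Comp_Hom[OF sT l]
  note m_eq = LUnit_Tensor_eq_Comp_right[OF s' t']
  have m: "\<ll> \<I> \<bullet> (s \<otimes> t) \<in> Hom C ?P \<I>"
    using Comp_Hom[OF Tensor_Hom[OF s' t'] LUnit_Hom[OF Unit_Obj]] .
  have "monic C (\<ll> ?T \<bullet> (s \<otimes> \<ii>\<dd> ?T))"
    using monic_Comp[OF sT firm[OF s t] l is_iso_monic[OF l LUnit_iso[OF T]]] .
  then have "monic C (\<ll> \<I> \<bullet> (s \<otimes> t))"
    using monic_Comp[OF lsT _ t' subunitD(3)[OF t]] m_eq by simp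
  moreover have "is_iso C ((\<ll> \<I> \<bullet> (s \<otimes> t)) \<otimes> \<ii>\<dd> ?P)"
  proof -
    have "is_iso C (s \<otimes> \<ii>\<dd> (?T \<boxtimes> ?P))"
      using is_iso_Tensor_TensorObj_right[OF s' T P
          is_iso_Tensor_TensorObj_left[OF s' S T subunitD(5)[OF s]]] .
    then have "is_iso C ((s \<otimes> \<ii>\<dd> ?T) \<otimes> \<ii>\<dd> ?P)"
      using is_iso_Tensor_assoc[OF s' T P] by blast
    moreover have "is_iso C (\<ll> ?T \<otimes> \<ii>\<dd> ?P)"
      using is_iso_Tensor[OF l LUnit_iso[OF T] iP is_iso_Ident[OF P]] .
    ultimately have "is_iso C ((\<ll> ?T \<bullet> (s \<otimes> \<ii>\<dd> ?T)) \<otimes> \<ii>\<dd> ?P)"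
      using is_iso_Comp[OF Tensor_Hom[OF sT iP] _ Tensor_Hom[OF l iP]]
        Comp_Tensor_Ident[OF sT l P] by simp
    moreover have "is_iso C (t \<otimes> \<ii>\<dd> ?P)"
      using is_iso_Tensor_TensorObj_right[OF t' S T subunitD(5)[OF t]] .
    ultimately show ?thesis
      using is_iso_Comp[OF Tensor_Hom[OF lsT iP] _ Tensor_Hom[OF t' iP]]
        Comp_Tensor_Ident[OF lsT t' P] m_eq by simp
  qed
  ultimately show ?thesis
    using HomD[OF m] by (simp add: subunit_def monos_into_def)
qed

lemma greatest_Lower_subunit_tensor:
  assumes s: "subunit C s" and t: "subunit C t"
  shows "greatest (ISub_order C) (subobject_class C (\<ll> \<I> \<bullet> (s \<otimes> t)))
    (Lower (ISub_order C) {subobject_class C s, subobject_class C t})"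
proof -
  let ?m = "\<ll> \<I> \<bullet> (s \<otimes> t)"
  interpret partial_order "ISub_order C"
    by (rule partial_order_ISub_order)
  note s' = subunitD(2)[OF s] and t' = subunitD(2)[OF t]
  note m = subunit_tensor[OF s t]
  show ?thesis
  proof (rule greatest_LowerI)
    fix x assume "x \<in> {subobject_class C s, subobject_class C t}"
    then show "subobject_class C ?m \<sqsubseteq>\<^bsub>ISub_order C\<^esub> x"
      using ISub_order_le_iff[OF m s] ISub_order_le_iff[OF m t]
        LUnit_Tensor_factors_through_left[OF s' t'] LUnit_Tensor_factors_through_right[OF s' t'] by auto
  next
    fix y assume y: "y \<in> Lower (ISub_order C) {subobject_class C s, subobject_class C t}"
    then have "y \<in> carrier (ISub_order C)"
      by (auto simp: Lower_def)
    then obtain r where r: "subunit C r" "y = subobject_class C r"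
      using ISub_orderE by metis
    have "factors_through C r s" "factors_through C r t"
      using y r ISub_order_le_iff s t subobject_class_in_ISub_order by (auto simp: Lower_def)
    then show "y \<sqsubseteq>\<^bsub>ISub_order C\<^esub> subobject_class C ?m"
      using subunit_factors_through_LUnit_Tensor[OF r(1) s' t'] ISub_order_le_iff[OF r(1) m] r(2) by simp
  qed (use s t m subobject_class_in_ISub_order in auto)
qed

lemma lower_semilattice_ISub_order: "lower_semilattice (ISub_order C)"
proof -
  interpret partial_order "ISub_order C"
    by (rule partial_order_ISub_order)
  show ?thesis
  proof
    fix x y assume "x \<in> carrier (ISub_order C)" "y \<in> carrier (ISub_order C)"
    then show "\<exists>m. greatest (ISub_order C) m (Lower (ISub_order C) {x, y})"
      using ISub_orderE greatest_Lower_subunit_tensor by metis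
  qed
qed

lemma ISub_order_meet:
  assumes "subunit C s" "subunit C t"
  shows "subobject_class C s \<sqinter>\<^bsub>ISub_order C\<^esub> subobject_class C t
    = subobject_class C (\<ll> \<I> \<bullet> (s \<otimes> t))"
proof -
  interpret partial_order "ISub_order C"
    by (rule partial_order_ISub_order)
  note glb = greatest_Lower_subunit_tensor[OF assms]
  show ?thesis
    unfolding meet_def Lattice.inf_def using glb greatest_unique[OF _ glb] by (rule some_equality)
qed

end

theorem proposition2p9:
  fixes C :: "('o, 'm, 'z) braided_category_scheme" (structure)
  assumes "firm_category C"
  shows "lower_semilattice (ISub_order C)
    \<and> (\<forall>s t. subunit C s \<longrightarrow> subunit C t \<longrightarrow>
        (subobject_class C s \<sqsubseteq>\<^bsub>ISub_order C\<^esub> subobject_class C t \<longleftrightarrow> factors_through C s t))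
    \<and> greatest (ISub_order C) (subobject_class C (\<ii>\<dd> \<I>)) (carrier (ISub_order C))
    \<and> (\<forall>s t. subunit C s \<longrightarrow> subunit C t \<longrightarrow>
        subunit C (\<ll> \<I> \<bullet> (s \<otimes> t))
        \<and> subobject_class C s \<sqinter>\<^bsub>ISub_order C\<^esub> subobject_class C t
          = subobject_class C (\<ll> \<I> \<bullet> (s \<otimes> t)))"
proof -
  interpret firm_category C by fact
  show ?thesis
    using lower_semilattice_ISub_order ISub_order_le_iff greatest_ISub_order_Unit subunit_tensor
      ISub_order_meet by blast
qed

end
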